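(* Let $X^{(\mathrm{p})}=(X^{(\mathrm{p})}_t)_{t\in[0,T]}$ be a time-dependent Ornstein--Uhlenbeck process, let $A\in\mathbb{R}$ and $\lambda\ge0$, and let $X^{(\mathrm{c})}:=2A-X^{(\mathrm{p})}$, which is again a time-dependent Ornstein--Uhlenbeck process. Let $$V_{\mathrm{p}}(t,x):=\sup_{0\le\tau\le T-t}\mathbb{E}\big[e^{-\lambda\tau}(A-X^{(\mathrm{p})}_{t+\tau})^+\,\big|\,X^{(\mathrm{p})}_t=x\big],\qquad V_{\mathrm{c}}(t,x):=\sup_{0\le\tau\le T-t}\mathbb{E}\big[e^{-\lambda\tau}(X^{(\mathrm{c})}_{t+\tau}-A)^+\,\big|\,X^{(\mathrm{c})}_t=x\big]$$ be the value functions of the American put written on $X^{(\mathrm{p})}$ and of the American call written on $X^{(\mathrm{c})}$, both with strike price $A$. Then $$V_{\mathrm{p}}(t,x)=V_{\mathrm{c}}(t,2A-x)\quad\text{for all }(t,x)\in[0,T]\times\mathbb{R}.$$ Moreover, if $b_{\mathrm{p}}:[0,T]\to\mathbb{R}$ is the optimal stopping boundary associated with $V_{\mathrm{p}}$, and $b_{\mathrm{c}}(t):=2A-b_{\mathrm{p}}(t)$, then the optimal exercise strategy for the call option is to stop the process $X^{(\mathrm{c})}$ the first time it is at or above the function $b_{\mathrm{c}}$ (or at maturity $T$ if this does not happen before).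
   Context: A time-dependent Ornstein--Uhlenbeck process here is the strong solution $X=(X_s)_{s\in[0,T]}$ of $dX_s=\theta(s)(\alpha(s)-X_s)\,ds+dW_s$, where $W$ is a standard Brownian motion and $\theta,\alpha:[0,T]\to\mathbb{R}$ are continuously differentiable with $\theta(s)>0$ for all $s\in[0,T]$. Suprema are over all random times $\tau\in[0,T-t]$ such that $t+\tau$ is a stopping time with respect to the natural filtration of the driving Brownian motion. The optimal stopping boundary $b_{\mathrm{p}}$ of the put is defined by $b_{\mathrm{p}}(t)=\sup\{x\in\mathbb{R}:V_{\mathrm{p}}(t,x)=(A-x)^+\}$ for $t\in[0,T)$ and $b_{\mathrm{p}}(T)=\lim_{t\to T}b_{\mathrm{p}}(t)$. It is known that $b_{\mathrm{p}}$ is real-valued, that $\{(t,x)\in[0,T]\times\mathbb{R}:V_{\mathrm{p}}(t,x)=(A-x)^+\}=\{(t,x)\in[0,T)\times\mathbb{R}:x\le b_{\mathrm{p}}(t)\}\cup(\{T\}\times\mathbb{R})$, and that the first hitting time of this set by $(t+s,X^{(\mathrm{p})}_{t+s})_{s\in[0,T-t]}$ attains the supremum in $V_{\mathrm{p}}(t,x)$. An exercise strategy (stopping time) is optimal if it attains the supremum in the corresponding value function. *)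

theory Defs
  imports "HOL-Probability.Probability"
begin

definition cont_diff_on :: "real set \<Rightarrow> (real \<Rightarrow> real) \<Rightarrow> bool" where
  "cont_diff_on S f \<longleftrightarrow>
     (\<exists>f'. continuous_on S f' \<and> (\<forall>s\<in>S. (f has_real_derivative f' s) (at s within S)))"

text \<open>The raw (not augmented) filtration of the paths on [0,s].\<close>

definition natural_filtration :: "'a measure \<Rightarrow> (real \<Rightarrow> 'a \<Rightarrow> real) \<Rightarrow> real \<Rightarrow> 'a measure" where
  "natural_filtration M W s =
     sigma (space M) {W u -` B \<inter> space M | u B. u \<in> {0..s} \<and> B \<in> sets borel}"

text \<open>Standard Brownian motion with time set [0,T]. All paths are continuous, so that first
  entry times of closed sets are stopping times of the raw filtration.\<close>

definition brownian_motion :: "'a measure \<Rightarrow> real \<Rightarrow> (real \<Rightarrow> 'a \<Rightarrow> real) \<Rightarrow> bool" where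
  "brownian_motion M T W \<longleftrightarrow>
     prob_space M \<and>
     (\<forall>s\<in>{0..T}. W s \<in> borel_measurable M) \<and>
     (AE \<omega> in M. W 0 \<omega> = 0) \<and>
     (\<forall>\<omega>\<in>space M. continuous_on {0..T} (\<lambda>s. W s \<omega>)) \<and>
     (\<forall>r s. 0 \<le> r \<and> r < s \<and> s \<le> T \<longrightarrow>
        distributed M lborel (\<lambda>\<omega>. W s \<omega> - W r \<omega>) (normal_density 0 (sqrt (s - r))) \<and>
        prob_space.indep_set M
          (sets (natural_filtration M W r))
          (sets (vimage_algebra (space M) (\<lambda>\<omega>. W s \<omega> - W r \<omega>) borel)))"

text \<open>Strong solution on [t,T] of dY = theta (alpha - Y) ds + dW. The noise is additive, so the
  stochastic integral of 1 against W is the increment of W.\<close>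

definition OU_solution ::
  "'a measure \<Rightarrow> real \<Rightarrow> (real \<Rightarrow> 'a \<Rightarrow> real) \<Rightarrow> (real \<Rightarrow> real) \<Rightarrow> (real \<Rightarrow> real) \<Rightarrow>
   real \<Rightarrow> (real \<Rightarrow> 'a \<Rightarrow> real) \<Rightarrow> bool" where
  "OU_solution M T W \<theta> \<alpha> t Y \<longleftrightarrow>
     (\<forall>s\<in>{t..T}. Y s \<in> borel_measurable (natural_filtration M W s)) \<and>
     (\<forall>\<omega>\<in>space M. continuous_on {t..T} (\<lambda>s. Y s \<omega>)) \<and>
     (AE \<omega> in M. \<forall>s\<in>{t..T}.
        Y s \<omega> = Y t \<omega> + integral {t..s} (\<lambda>u. \<theta> u * (\<alpha> u - Y u \<omega>)) + (W s \<omega> - W t \<omega>))"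

definition OU_process ::
  "'a measure \<Rightarrow> real \<Rightarrow> (real \<Rightarrow> 'a \<Rightarrow> real) \<Rightarrow> (real \<Rightarrow> real) \<Rightarrow> (real \<Rightarrow> real) \<Rightarrow>
   (real \<Rightarrow> 'a \<Rightarrow> real) \<Rightarrow> bool" where
  "OU_process M T W \<theta> \<alpha> X \<longleftrightarrow>
     brownian_motion M T W \<and>
     cont_diff_on {0..T} \<theta> \<and> cont_diff_on {0..T} \<alpha> \<and> (\<forall>s\<in>{0..T}. 0 < \<theta> s) \<and>
     OU_solution M T W \<theta> \<alpha> 0 X"

text \<open>The law of an Ornstein--Uhlenbeck process X conditioned on X t = x is, as usual for the
  Markov family of an SDE, that of the solution of the same SDE (same driving W) started from x
  at time t. This solution is unique up to indistinguishability.\<close>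

definition OU_started ::
  "'a measure \<Rightarrow> real \<Rightarrow> (real \<Rightarrow> 'a \<Rightarrow> real) \<Rightarrow> (real \<Rightarrow> real) \<Rightarrow> (real \<Rightarrow> real) \<Rightarrow>
   real \<Rightarrow> real \<Rightarrow> (real \<Rightarrow> 'a \<Rightarrow> real) \<Rightarrow> bool" where
  "OU_started M T W \<theta> \<alpha> t x Y \<longleftrightarrow>
     OU_solution M T W \<theta> \<alpha> t Y \<and> (AE \<omega> in M. Y t \<omega> = x)"

definition exercise_time ::
  "'a measure \<Rightarrow> real \<Rightarrow> (real \<Rightarrow> 'a \<Rightarrow> real) \<Rightarrow> real \<Rightarrow> ('a \<Rightarrow> real) \<Rightarrow> bool" where
  "exercise_time M T W t \<tau> \<longleftrightarrow>
     (\<forall>\<omega>\<in>space M. 0 \<le> \<tau> \<omega> \<and> \<tau> \<omega> \<le> T - t) \<and>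
     stopping_time (natural_filtration M W) (\<lambda>\<omega>. t + \<tau> \<omega>)"

definition expected_gain ::
  "'a measure \<Rightarrow> real \<Rightarrow> (real \<Rightarrow> real) \<Rightarrow> real \<Rightarrow> (real \<Rightarrow> 'a \<Rightarrow> real) \<Rightarrow> ('a \<Rightarrow> real) \<Rightarrow> real" where
  "expected_gain M lam g t Y \<tau> = (\<integral>\<omega>. exp (- lam * \<tau> \<omega>) * g (Y (t + \<tau> \<omega>) \<omega>) \<partial>M)"

definition value_fun ::
  "'a measure \<Rightarrow> real \<Rightarrow> (real \<Rightarrow> 'a \<Rightarrow> real) \<Rightarrow> (real \<Rightarrow> real) \<Rightarrow> (real \<Rightarrow> real) \<Rightarrow>
   real \<Rightarrow> (real \<Rightarrow> real) \<Rightarrow> real \<Rightarrow> real \<Rightarrow> real" where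
  "value_fun M T W \<theta> \<alpha> lam g t x =
     Sup {expected_gain M lam g t Y \<tau> | Y \<tau>.
            OU_started M T W \<theta> \<alpha> t x Y \<and> exercise_time M T W t \<tau>}"

definition optimal_exercise_time ::
  "'a measure \<Rightarrow> real \<Rightarrow> (real \<Rightarrow> 'a \<Rightarrow> real) \<Rightarrow> (real \<Rightarrow> real) \<Rightarrow> (real \<Rightarrow> real) \<Rightarrow>
   real \<Rightarrow> (real \<Rightarrow> real) \<Rightarrow> real \<Rightarrow> real \<Rightarrow> (real \<Rightarrow> 'a \<Rightarrow> real) \<Rightarrow> ('a \<Rightarrow> real) \<Rightarrow> bool" where
  "optimal_exercise_time M T W \<theta> \<alpha> lam g t x Y \<tau> \<longleftrightarrow>
     exercise_time M T W t \<tau> \<and>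
     expected_gain M lam g t Y \<tau> = value_fun M T W \<theta> \<alpha> lam g t x"

definition put_payoff :: "real \<Rightarrow> real \<Rightarrow> real" where
  "put_payoff A y = max (A - y) 0"

definition call_payoff :: "real \<Rightarrow> real \<Rightarrow> real" where
  "call_payoff A y = max (y - A) 0"

definition stopping_set ::
  "real \<Rightarrow> (real \<Rightarrow> real \<Rightarrow> real) \<Rightarrow> (real \<Rightarrow> real) \<Rightarrow> (real \<times> real) set" where
  "stopping_set T V g = {(t, x). t \<in> {0..T} \<and> V t x = g x}"

text \<open>The supremum is taken in the extended reals, so that real-valuedness of b is part of
  the predicate.\<close>

definition put_boundary ::
  "real \<Rightarrow> (real \<Rightarrow> real \<Rightarrow> real) \<Rightarrow> real \<Rightarrow> (real \<Rightarrow> real) \<Rightarrow> bool" where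
  "put_boundary T V A b \<longleftrightarrow>
     (\<forall>t\<in>{0..<T}. ereal (b t) = Sup (ereal ` {x. V t x = put_payoff A x})) \<and>
     (b \<longlongrightarrow> b T) (at_left T)"

definition hitting_time ::
  "real \<Rightarrow> real \<Rightarrow> (real \<times> real) set \<Rightarrow> (real \<Rightarrow> 'a \<Rightarrow> real) \<Rightarrow> 'a \<Rightarrow> real" where
  "hitting_time T t D Y \<omega> = Inf {s \<in> {0..T - t}. (t + s, Y (t + s) \<omega>) \<in> D}"

definition first_time_at_or_above ::
  "real \<Rightarrow> real \<Rightarrow> (real \<Rightarrow> real) \<Rightarrow> (real \<Rightarrow> 'a \<Rightarrow> real) \<Rightarrow> 'a \<Rightarrow> real" where
  "first_time_at_or_above T t b Y \<omega> =
     Inf (insert (T - t) {s \<in> {0..T - t}. b (t + s) \<le> Y (t + s) \<omega>})"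

end

theory Submission
  imports Defs
begin

text \<open>Reflection at the strike, \<open>y \<mapsto> 2 * A - y\<close>, is an involution that turns solutions driven by \<open>W\<close>
  into solutions driven by \<open>- W\<close>, and the put payoff into the call payoff. Since \<open>W\<close> and \<open>- W\<close>
  generate the same filtration, both options have the same exercise times, so reflection matches
  the two optimal stopping problems path by path.\<close>

lemma natural_filtration_uminus_subset:
  fixes W :: "real \<Rightarrow> 'a \<Rightarrow> real"
  shows "{(\<lambda>\<omega>. - W u \<omega>) -` B \<inter> S | u B. u \<in> {0..s} \<and> B \<in> sets (borel :: real measure)}
    \<subseteq> {W u -` B \<inter> S | u B. u \<in> {0..s} \<and> B \<in> sets borel}"
proof safe
  fix u :: real and B :: "real set"
  assume u: "u \<in> {0..s}" and B: "B \<in> sets borel"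
  have "uminus -` B \<inter> space borel \<in> sets (borel :: real measure)"
    by (rule measurable_sets[OF _ B]) measurable
  then show "\<exists>v C. (\<lambda>\<omega>. - W u \<omega>) -` B \<inter> S = W v -` C \<inter> S \<and> v \<in> {0..s} \<and> C \<in> sets borel"
    using u by (intro exI[of _ u] exI[of _ "uminus -` B"]) auto
qed

lemma natural_filtration_uminus [simp]:
  "natural_filtration M (\<lambda>s \<omega>. - W s \<omega>) = natural_filtration M W"
proof
  fix s
  show "natural_filtration M (\<lambda>s \<omega>. - W s \<omega>) s = natural_filtration M W s"
    using natural_filtration_uminus_subset[of W "space M" s]
      natural_filtration_uminus_subset[of "\<lambda>s \<omega>. - W s \<omega>" "space M" s]
    unfolding natural_filtration_def
    by (intro arg_cong[where f = "sigma (space M)"] equalityI) simp_all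
qed

text \<open>\<open>- f\<close> is measurable for the sigma-algebra generated by \<open>f\<close>.
  This serves the independence clause of Brownian motion, with \<open>f\<close> an
  increment.\<close>

lemma sets_vimage_algebra_uminus_subset:
  fixes f :: "'a \<Rightarrow> real"
  shows "sets (vimage_algebra S (\<lambda>\<omega>. - f \<omega>) borel) \<subseteq> sets (vimage_algebra S f borel)"
proof -
  have "f \<in> vimage_algebra S f borel \<rightarrow>\<^sub>M borel"
    by (rule measurable_vimage_algebra1) simp
  then have minus: "(\<lambda>\<omega>. - f \<omega>) \<in> vimage_algebra S f borel \<rightarrow>\<^sub>M borel"
    by measurable
  then show ?thesis
    unfolding sets_vimage_algebra2[of "\<lambda>\<omega>. - f \<omega>" S borel, simplified]
    using measurable_sets[OF minus] by auto
qed

lemma sets_vimage_algebra_uminus: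
  fixes f :: "'a \<Rightarrow> real"
  shows "sets (vimage_algebra S (\<lambda>\<omega>. - f \<omega>) borel) = sets (vimage_algebra S f borel)"
  using sets_vimage_algebra_uminus_subset[of S f]
    sets_vimage_algebra_uminus_subset[of S "\<lambda>\<omega>. - f \<omega>"]
  by (intro equalityI) simp_all

text \<open>Centred normal laws are symmetric, and neither the past nor the sigma-algebra of an
  increment changes under negation, so independence carries over.\<close>

lemma brownian_motion_uminus:
  assumes "brownian_motion M T W"
  shows "brownian_motion M T (\<lambda>s \<omega>. - W s \<omega>)"
proof -
  interpret prob_space M
    using assms by (simp add: brownian_motion_def)
  have incr: "(\<lambda>\<omega>. - W s \<omega> - - W r \<omega>) = (\<lambda>\<omega>. - (W s \<omega> - W r \<omega>))" for r s
    by auto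
  have dist: "distributed M lborel (\<lambda>\<omega>. - (W s \<omega> - W r \<omega>)) (normal_density 0 (sqrt (s - r)))"
    if "0 \<le> r" "r < s" "s \<le> T" for r s
  proof -
    have "distributed M lborel (\<lambda>\<omega>. W s \<omega> - W r \<omega>) (normal_density 0 (sqrt (s - r)))"
      using assms that by (simp add: brownian_motion_def)
    \<comment> \<open>Factor \<open>-1\<close> and shift \<open>0\<close> keep the mean zero and
      multiply the deviation by \<open>\<bar>-1\<bar> = 1\<close>; \<open>r < s\<close> makes the
      deviation positive.\<close>
    from normal_density_affine[OF this, of "-1" 0] that show ?thesis
      by simp
  qed
  show ?thesis
    using assms dist unfolding brownian_motion_def incr sets_vimage_algebra_uminus
    by (auto intro: continuous_on_minus)
qed

text \<open>The drift depends linearly on the gap \<alpha> - Y. Reflecting both the mean level and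
  the path flips the sign of this gap, and the remaining sign of the noise is absorbed by
  \<open>- W\<close>. Adaptedness survives because \<open>- W\<close> has the filtration of
  \<open>W\<close>.\<close>

lemma OU_solution_reflect:
  assumes "OU_solution M T W \<theta> \<alpha> t Y"
  shows "OU_solution M T (\<lambda>s \<omega>. - W s \<omega>) \<theta> (\<lambda>s. c - \<alpha> s) t (\<lambda>s \<omega>. c - Y s \<omega>)"
proof -
  have drift: "\<theta> u * (c - \<alpha> u - (c - y)) = - (\<theta> u * (\<alpha> u - y))" for u y
    by (simp add: algebra_simps)
  have "AE \<omega> in M. \<forall>s\<in>{t..T}.
      Y s \<omega> = Y t \<omega> + integral {t..s} (\<lambda>u. \<theta> u * (\<alpha> u - Y u \<omega>)) + (W s \<omega> - W t \<omega>)"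
    using assms by (simp add: OU_solution_def)
  then have "AE \<omega> in M. \<forall>s\<in>{t..T}. c - Y s \<omega> = c - Y t \<omega>
      + integral {t..s} (\<lambda>u. \<theta> u * (c - \<alpha> u - (c - Y u \<omega>))) + (- W s \<omega> - - W t \<omega>)"
    unfolding drift integral_neg by eventually_elim (auto simp: algebra_simps)
  then show ?thesis
    using assms unfolding OU_solution_def
    by (auto intro!: continuous_intros)
qed

lemma cont_diff_on_const_minus:
  assumes "cont_diff_on S f"
  shows "cont_diff_on S (\<lambda>s. c - f s)"
proof -
  obtain f' where "continuous_on S f'"
    and "\<And>s. s \<in> S \<Longrightarrow> (f has_real_derivative f' s) (at s within S)"
    using assms by (auto simp: cont_diff_on_def)
  then show ?thesis
    unfolding cont_diff_on_def
    by (intro exI[of _ "\<lambda>s. - f' s"]) (auto intro!: continuous_intros derivative_eq_intros)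
qed

lemma OU_process_reflect:
  assumes "OU_process M T W \<theta> \<alpha> X"
  shows "OU_process M T (\<lambda>s \<omega>. - W s \<omega>) \<theta> (\<lambda>s. c - \<alpha> s) (\<lambda>s \<omega>. c - X s \<omega>)"
  using assms unfolding OU_process_def
  by (simp add: brownian_motion_uminus cont_diff_on_const_minus OU_solution_reflect)

lemma OU_started_reflect:
  assumes "OU_started M T W \<theta> \<alpha> t x Y"
  shows "OU_started M T (\<lambda>s \<omega>. - W s \<omega>) \<theta> (\<lambda>s. c - \<alpha> s) t (c - x) (\<lambda>s \<omega>. c - Y s \<omega>)"
  using assms unfolding OU_started_def by (simp add: OU_solution_reflect)

text \<open>Reflection with the same \<open>c\<close> is an involution, so a second application
  restores \<open>W\<close> and \<alpha>.\<close>

lemma OU_started_reflect_back: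
  assumes "OU_started M T (\<lambda>s \<omega>. - W s \<omega>) \<theta> (\<lambda>s. c - \<alpha> s) t x Y"
  shows "OU_started M T W \<theta> \<alpha> t (c - x) (\<lambda>s \<omega>. c - Y s \<omega>)"
  using OU_started_reflect[OF assms, of c] by simp

lemma exercise_time_uminus [simp]:
  "exercise_time M T (\<lambda>s \<omega>. - W s \<omega>) t \<tau> \<longleftrightarrow> exercise_time M T W t \<tau>"
  by (simp add: exercise_time_def)

text \<open>Here the centre of reflection has to be the strike:
  \<open>A - (2 * A - y) = y - A\<close>. The discount factor depends on \<tau> alone and is
  unaffected.\<close>

lemma expected_gain_reflect:
  "expected_gain M lam (put_payoff A) t (\<lambda>s \<omega>. 2 * A - Y s \<omega>) \<tau> =
    expected_gain M lam (call_payoff A) t Y \<tau>"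
  by (simp add: expected_gain_def put_payoff_def call_payoff_def)

text \<open>Both suprema are over the same set of reals: pairing \<open>Y\<close> with
  \<open>2 * A - Y\<close> and keeping \<tau> matches the attainable gains one by one. Equality of
  the sets gives equality of \<open>Sup\<close>, whatever value it takes on them.\<close>

lemma value_fun_put_call:
  "value_fun M T W \<theta> \<alpha> lam (put_payoff A) t x =
    value_fun M T (\<lambda>s \<omega>. - W s \<omega>) \<theta> (\<lambda>s. 2 * A - \<alpha> s) lam (call_payoff A) t (2 * A - x)"
proof -
  have "(\<exists>Y \<tau>. e = expected_gain M lam (put_payoff A) t Y \<tau> \<and>
          OU_started M T W \<theta> \<alpha> t x Y \<and> exercise_time M T W t \<tau>) \<longleftrightarrow>
        (\<exists>Y \<tau>. e = expected_gain M lam (call_payoff A) t Y \<tau> \<and>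
          OU_started M T (\<lambda>s \<omega>. - W s \<omega>) \<theta> (\<lambda>s. 2 * A - \<alpha> s) t (2 * A - x) Y \<and>
          exercise_time M T W t \<tau>)" (is "?put \<longleftrightarrow> ?call") for e
  proof
    assume ?put
    then obtain Y \<tau> where Y: "e = expected_gain M lam (put_payoff A) t Y \<tau>"
      "OU_started M T W \<theta> \<alpha> t x Y" "exercise_time M T W t \<tau>"
      by blast
    have "e = expected_gain M lam (call_payoff A) t (\<lambda>s \<omega>. 2 * A - Y s \<omega>) \<tau>"
      \<comment> \<open>The identity is applied to the reflected path, so that its put side,
        reflected twice, simplifies to \<open>Y\<close>.\<close>
      using Y(1) expected_gain_reflect[of M lam A t "\<lambda>s \<omega>. 2 * A - Y s \<omega>" \<tau>] by simp
    then show ?call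
      using OU_started_reflect[OF Y(2)] Y(3) by blast
  next
    assume ?call
    then obtain Y \<tau> where Y: "e = expected_gain M lam (call_payoff A) t Y \<tau>"
      "OU_started M T (\<lambda>s \<omega>. - W s \<omega>) \<theta> (\<lambda>s. 2 * A - \<alpha> s) t (2 * A - x) Y"
      "exercise_time M T W t \<tau>"
      by blast
    have "OU_started M T W \<theta> \<alpha> t x (\<lambda>s \<omega>. 2 * A - Y s \<omega>)"
      using OU_started_reflect_back[OF Y(2)] by simp
    then show ?put
      using Y(1,3) expected_gain_reflect[of M lam A t Y \<tau>] by metis
  qed
  then show ?thesis
    by (simp add: value_fun_def)
qed

text \<open>Below \<open>T\<close>, \<open>c - y \<le> b\<close> is the same as
  \<open>c - b \<le> y\<close>. The slice at \<open>T\<close> is always hit and becomes the inserted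
  \<open>T - t\<close>, the exercise at maturity; the comparison with \<open>b\<close> at
  \<open>T\<close> itself can add only this same point.\<close>

lemma hitting_time_reflect:
  assumes "t \<in> {0..T}"
  shows "hitting_time T t ({(t, x). t \<in> {0..<T} \<and> x \<le> b t} \<union> {T} \<times> UNIV) (\<lambda>s \<omega>. c - Y s \<omega>) =
    first_time_at_or_above T t (\<lambda>t. c - b t) Y"
proof
  fix \<omega>
  have "{s \<in> {0..T - t}.
      (t + s, c - Y (t + s) \<omega>) \<in> {(t, x). t \<in> {0..<T} \<and> x \<le> b t} \<union> {T} \<times> UNIV} =
      insert (T - t) {s \<in> {0..T - t}. c - b (t + s) \<le> Y (t + s) \<omega>}"
    \<comment> \<open>\<open>t \<le> T\<close> puts \<open>T - t\<close> into
      \<open>{0..T - t}\<close>, and \<open>0 \<le> t\<close> keeps \<open>t + s\<close>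
      nonnegative.\<close>
    using assms by auto
  then show "hitting_time T t ({(t, x). t \<in> {0..<T} \<and> x \<le> b t} \<union> {T} \<times> UNIV)
      (\<lambda>s \<omega>. c - Y s \<omega>) \<omega> = first_time_at_or_above T t (\<lambda>t. c - b t) Y \<omega>"
    unfolding hitting_time_def first_time_at_or_above_def by (rule arg_cong)
qed

text \<open>The gain of \<tau> and the value it has to attain are each carried over; the value at
  \<open>2 * A - x\<close> reflects to the call value at \<open>x\<close>.\<close>

lemma optimal_exercise_time_put_call:
  assumes "optimal_exercise_time M T W \<theta> \<alpha> lam (put_payoff A) t (2 * A - x)
    (\<lambda>s \<omega>. 2 * A - Y s \<omega>) \<tau>"
  shows "optimal_exercise_time M T (\<lambda>s \<omega>. - W s \<omega>) \<theta> (\<lambda>s. 2 * A - \<alpha> s) lam (call_payoff A) t x Y \<tau>"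
  using assms unfolding optimal_exercise_time_def
  by (simp add: expected_gain_reflect value_fun_put_call)

theorem mainTheorem4:
  fixes M :: "'a measure" and T A lam :: real
    and W Xp Xc :: "real \<Rightarrow> 'a \<Rightarrow> real"
    and \<theta> \<alpha> :: "real \<Rightarrow> real"
    and Vp Vc :: "real \<Rightarrow> real \<Rightarrow> real"
  assumes "0 < T" and "0 \<le> lam"
    and Xp: "OU_process M T W \<theta> \<alpha> Xp"
    and Xc: "Xc = (\<lambda>s \<omega>. 2 * A - Xp s \<omega>)"
    and Vp: "Vp = value_fun M T W \<theta> \<alpha> lam (put_payoff A)"
    and Vc: "Vc = value_fun M T (\<lambda>s \<omega>. - W s \<omega>) \<theta> (\<lambda>s. 2 * A - \<alpha> s) lam (call_payoff A)"
  shows "OU_process M T (\<lambda>s \<omega>. - W s \<omega>) \<theta> (\<lambda>s. 2 * A - \<alpha> s) Xc \<and>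
    (\<forall>t\<in>{0..T}. \<forall>x. Vp t x = Vc t (2 * A - x)) \<and>
    (\<forall>bp bc.
       put_boundary T Vp A bp \<and>
       stopping_set T Vp (put_payoff A) = {(t, x). t \<in> {0..<T} \<and> x \<le> bp t} \<union> {T} \<times> UNIV \<and>
       (\<forall>t\<in>{0..T}. \<forall>x Y. OU_started M T W \<theta> \<alpha> t x Y \<longrightarrow>
          optimal_exercise_time M T W \<theta> \<alpha> lam (put_payoff A) t x Y
            (hitting_time T t (stopping_set T Vp (put_payoff A)) Y)) \<and>
       bc = (\<lambda>t. 2 * A - bp t) \<longrightarrow>
       (\<forall>t\<in>{0..T}. \<forall>x Y. OU_started M T (\<lambda>s \<omega>. - W s \<omega>) \<theta> (\<lambda>s. 2 * A - \<alpha> s) t x Y \<longrightarrow>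
          optimal_exercise_time M T (\<lambda>s \<omega>. - W s \<omega>) \<theta> (\<lambda>s. 2 * A - \<alpha> s) lam (call_payoff A) t x Y
            (first_time_at_or_above T t bc Y)))"
proof (intro conjI allI ballI impI)
  show "OU_process M T (\<lambda>s \<omega>. - W s \<omega>) \<theta> (\<lambda>s. 2 * A - \<alpha> s) Xc"
    unfolding Xc using Xp by (rule OU_process_reflect)
  show "Vp t x = Vc t (2 * A - x)" for t x
    unfolding Vp Vc by (rule value_fun_put_call)
next
  fix bp bc t x Y
  let ?D = "stopping_set T Vp (put_payoff A)"
  assume hyps: "put_boundary T Vp A bp \<and>
      ?D = {(t, x). t \<in> {0..<T} \<and> x \<le> bp t} \<union> {T} \<times> UNIV \<and>
      (\<forall>t\<in>{0..T}. \<forall>x Y. OU_started M T W \<theta> \<alpha> t x Y \<longrightarrow>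
        optimal_exercise_time M T W \<theta> \<alpha> lam (put_payoff A) t x Y (hitting_time T t ?D Y)) \<and>
      bc = (\<lambda>t. 2 * A - bp t)"
    and t: "t \<in> {0..T}"
    and Y: "OU_started M T (\<lambda>s \<omega>. - W s \<omega>) \<theta> (\<lambda>s. 2 * A - \<alpha> s) t x Y"
  have D: "?D = {(t, x). t \<in> {0..<T} \<and> x \<le> bp t} \<union> {T} \<times> UNIV"
    and bc: "bc = (\<lambda>t. 2 * A - bp t)"
    using hyps by blast+
  \<comment> \<open>The reflection of the call path \<open>Y\<close> solves the put equation from
    \<open>2 * A - x\<close>, so the assumed optimality of the put's hitting time applies to
    it.\<close>
  have "optimal_exercise_time M T W \<theta> \<alpha> lam (put_payoff A) t (2 * A - x)
      (\<lambda>s \<omega>. 2 * A - Y s \<omega>) (hitting_time T t ?D (\<lambda>s \<omega>. 2 * A - Y s \<omega>))"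
    using hyps t OU_started_reflect_back[OF Y] by blast
  also have "hitting_time T t ?D (\<lambda>s \<omega>. 2 * A - Y s \<omega>) = first_time_at_or_above T t bc Y"
    unfolding D bc using t by (rule hitting_time_reflect)
  finally show "optimal_exercise_time M T (\<lambda>s \<omega>. - W s \<omega>) \<theta> (\<lambda>s. 2 * A - \<alpha> s) lam
      (call_payoff A) t x Y (first_time_at_or_above T t bc Y)"
    by (rule optimal_exercise_time_put_call)
qed

end
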